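(* Let $(G,F)$ be a temporal cost graph with $n$ vertices and lifetime $T$ such that, for each vertex $v\in V(G)$, there are only three distinct triples $(u,t_1,t_2)$ with $u\ne v$ such that $F(v,u,t_1,t_2)$ or $F(u,v,t_1,t_2)$ (or both) is finite. Then \textsc{Changing Cost Temporal Orienteering} is solvable on any instance $((G,F),v_s,v_t,k,f)$ in $O((nTk)^2)$ time.
   Context: A temporal cost graph is a pair $(G,F)$ where $G=(V,E)$ is a static graph and $F:V\times V\times[T]\times[T]\to\mathbb{N}_0\cup\{\infty\}$ ($F(v_1,v_2,t_1,t_2)$ is the cost of departing $v_1$ at time $t_1$ and arriving at $v_2$ at time $t_2$), with $F(v_1,v_2,t_1,t_2)=\infty$ whenever $t_1\ge t_2$, $F(v,v,t_1,t_2)=0$ for all $v$ and $t_1<t_2$, and $F(v_1,v_2,t_1,t_2)>0$ whenever $v_1\ne v_2$; values of $F$ can be looked up in constant time. The lifetime $T$ is the latest time $t'$ such that $F(v,u,t,t')<\infty$ for some $v,u,t$. A valid walk is a sequence $(u_1,v_1,t_1,t_1'),\dots,(u_\ell,v_\ell,t_\ell,t_\ell')$ with $v_i=u_{i+1}$ and $t_i'\le t_{i+1}$ for consecutive entries, and $t_i<t_i'$, $F(u_i,v_i,t_i,t_i')<\infty$ for all $i$; its cost is $\sum_iF(u_i,v_i,t_i,t_i')$. \textsc{Changing Cost Temporal Orienteering}, on instance $((G,F),v_s,v_t,k,f)$: decide whether there is a valid walk from source $v_s$ to sink $v_t$ visiting at least $k$ distinct vertices (source and sink counted) with cost at most the budget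 $f$. *)

theory Defs
  imports Complex_Main "HOL-Library.Extended_Nat"
begin

section \<open>Temporal cost graphs\<close>

text \<open>
  The interval of times is \<open>{1..T}\<close>. A cost function is a total HOL function, but only its values
  on \<open>V \<times> V \<times> {1..T} \<times> {1..T}\<close> are meaningful: every notion below inspects \<open>F\<close> on that domain
  only, and nothing is assumed about \<open>F\<close> elsewhere.
\<close>

type_synonym 'v cost_fun = "'v \<Rightarrow> 'v \<Rightarrow> nat \<Rightarrow> nat \<Rightarrow> enat"

text \<open>
  The edges are ordered pairs, an undirected graph being a symmetric relation. Finiteness of \<open>F\<close>
  is not tied to \<open>E\<close>, and walks depend on \<open>F\<close> alone.
\<close>

definition temporal_cost_graph ::
    "'v set \<Rightarrow> ('v \<times> 'v) set \<Rightarrow> nat \<Rightarrow> 'v cost_fun \<Rightarrow> bool" where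
  "temporal_cost_graph V E T F \<longleftrightarrow>
     finite V \<and> E \<subseteq> V \<times> V \<and>
     (\<forall>u\<in>V. \<forall>v\<in>V. \<forall>t1\<in>{1..T}. \<forall>t2\<in>{1..T}. t1 \<ge> t2 \<longrightarrow> F u v t1 t2 = \<infinity>) \<and>
     (\<forall>v\<in>V. \<forall>t1\<in>{1..T}. \<forall>t2\<in>{1..T}. t1 < t2 \<longrightarrow> F v v t1 t2 = 0) \<and>
     (\<forall>u\<in>V. \<forall>v\<in>V. \<forall>t1\<in>{1..T}. \<forall>t2\<in>{1..T}. u \<noteq> v \<longrightarrow> F u v t1 t2 > 0)"

text \<open>
  \<open>T\<close> is both the bound of the time domain and the latest finite arrival time. Some arrival time
  must therefore be finite, which forces \<open>V \<noteq> {}\<close> and \<open>T \<ge> 2\<close>.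
\<close>

definition arrival_times :: "'v set \<Rightarrow> nat \<Rightarrow> 'v cost_fun \<Rightarrow> nat set" where
  "arrival_times V T F =
     {t' \<in> {1..T}. \<exists>v\<in>V. \<exists>u\<in>V. \<exists>t\<in>{1..T}. F v u t t' < \<infinity>}"

definition has_lifetime :: "'v set \<Rightarrow> nat \<Rightarrow> 'v cost_fun \<Rightarrow> bool" where
  "has_lifetime V T F \<longleftrightarrow>
     T \<in> arrival_times V T F \<and> (\<forall>t'\<in>arrival_times V T F. t' \<le> T)"

definition incident_triples ::
    "'v set \<Rightarrow> nat \<Rightarrow> 'v cost_fun \<Rightarrow> 'v \<Rightarrow> ('v \<times> nat \<times> nat) set" where
  "incident_triples V T F v =
     {(u, t1, t2). u \<in> V \<and> u \<noteq> v \<and> t1 \<in> {1..T} \<and> t2 \<in> {1..T} \<and>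
        (F v u t1 t2 < \<infinity> \<or> F u v t1 t2 < \<infinity>)}"


section \<open>Changing Cost Temporal Orienteering\<close>

text \<open>A step \<open>(u, v, t, t')\<close> departs from \<open>u\<close> at time \<open>t\<close> and arrives at \<open>v\<close> at time \<open>t'\<close>.\<close>

type_synonym 'v step = "'v \<times> 'v \<times> nat \<times> nat"

fun step_ok :: "'v set \<Rightarrow> nat \<Rightarrow> 'v cost_fun \<Rightarrow> 'v step \<Rightarrow> bool" where
  "step_ok V T F (u, v, t, t') \<longleftrightarrow>
     u \<in> V \<and> v \<in> V \<and> t \<in> {1..T} \<and> t' \<in> {1..T} \<and> t < t' \<and> F u v t t' < \<infinity>"

fun consecutive :: "'v step \<Rightarrow> 'v step \<Rightarrow> bool" where
  "consecutive (u1, v1, t1, t1') (u2, v2, t2, t2') \<longleftrightarrow> v1 = u2 \<and> t1' \<le> t2"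

definition valid_walk :: "'v set \<Rightarrow> nat \<Rightarrow> 'v cost_fun \<Rightarrow> 'v step list \<Rightarrow> bool" where
  "valid_walk V T F w \<longleftrightarrow>
     w \<noteq> [] \<and> (\<forall>x\<in>set w. step_ok V T F x) \<and>
     (\<forall>i. Suc i < length w \<longrightarrow> consecutive (w ! i) (w ! Suc i))"

definition walk_cost :: "'v cost_fun \<Rightarrow> 'v step list \<Rightarrow> enat" where
  "walk_cost F w = (\<Sum>(u, v, t, t')\<leftarrow>w. F u v t t')"

definition walk_source :: "'v step list \<Rightarrow> 'v" where
  "walk_source w = (case hd w of (u, v, t, t') \<Rightarrow> u)"

definition walk_sink :: "'v step list \<Rightarrow> 'v" where
  "walk_sink w = (case last w of (u, v, t, t') \<Rightarrow> v)"

definition visited :: "'v step list \<Rightarrow> 'v set" where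
  "visited w = (\<Union>(u, v, t, t')\<in>set w. {u, v})"

definition orienteering ::
    "'v set \<Rightarrow> nat \<Rightarrow> 'v cost_fun \<Rightarrow> 'v \<Rightarrow> 'v \<Rightarrow> nat \<Rightarrow> nat \<Rightarrow> bool" where
  "orienteering V T F vs vt k f \<longleftrightarrow>
     (\<exists>w. valid_walk V T F w \<and> walk_source w = vs \<and> walk_sink w = vt \<and>
          card (visited w) \<ge> k \<and> walk_cost F w \<le> enat f)"


section \<open>Machine model\<close>

text \<open>
  A structured random access machine with uniform cost. A program has finitely many named
  registers and an unbounded indirectly addressed memory; both hold natural numbers. The only
  arithmetic is addition and truncated subtraction: unit-cost multiplication on unbounded numbers
  would make the model unreasonably strong. The instruction \<open>Lookup\<close> is the constant-time access
  to the cost function.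
\<close>

type_synonym reg = string

datatype com =
    Skip
  | Const reg nat
  | Add reg reg reg
  | Sub reg reg reg
  | Load reg reg
  | Store reg reg
  | Lookup reg reg reg reg reg
  | Seq com com
  | IfLess reg reg com com
  | WhileLess reg reg com

text \<open>The first component of a state is the register file, the second is the memory.\<close>

type_synonym state = "(reg \<Rightarrow> nat) \<times> (nat \<Rightarrow> nat)"

fun cost_code :: "enat \<Rightarrow> nat" where
  "cost_code (enat c) = Suc c"
| "cost_code \<infinity> = 0"

text \<open>
  \<open>exec F P s t s'\<close>: started in \<open>s\<close> with access to \<open>F\<close>, the program \<open>P\<close> halts in \<open>s'\<close> after
  exactly \<open>t\<close> elementary instructions and tests.
\<close>

inductive exec :: "nat cost_fun \<Rightarrow> com \<Rightarrow> state \<Rightarrow> nat \<Rightarrow> state \<Rightarrow> bool" for F where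
  Skip: "exec F Skip s 1 s"
| Const: "exec F (Const x c) (r, m) 1 (r(x := c), m)"
| Add: "exec F (Add x y z) (r, m) 1 (r(x := r y + r z), m)"
| Sub: "exec F (Sub x y z) (r, m) 1 (r(x := r y - r z), m)"
| Load: "exec F (Load x a) (r, m) 1 (r(x := m (r a)), m)"
| Store: "exec F (Store a x) (r, m) 1 (r, m(r a := r x))"
| Lookup: "exec F (Lookup x u v t1 t2) (r, m) 1
             (r(x := cost_code (F (r u) (r v) (r t1) (r t2))), m)"
| Seq: "exec F P s t s' \<Longrightarrow> exec F Q s' t' s'' \<Longrightarrow> exec F (Seq P Q) s (t + t') s''"
| IfTrue: "r x < r y \<Longrightarrow> exec F P (r, m) t s' \<Longrightarrow> exec F (IfLess x y P Q) (r, m) (1 + t) s'"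
| IfFalse: "\<not> r x < r y \<Longrightarrow> exec F Q (r, m) t s' \<Longrightarrow> exec F (IfLess x y P Q) (r, m) (1 + t) s'"
| WhileFalse: "\<not> r x < r y \<Longrightarrow> exec F (WhileLess x y P) (r, m) 1 (r, m)"
| WhileTrue: "r x < r y \<Longrightarrow> exec F P (r, m) t s' \<Longrightarrow> exec F (WhileLess x y P) s' t' s'' \<Longrightarrow>
    exec F (WhileLess x y P) (r, m) (1 + t + t') s''"

inductive_cases exec_elims:
  "exec F Skip s t s'"
  "exec F (Const x c) s t s'"
  "exec F (Add x y z) s t s'"
  "exec F (Sub x y z) s t s'"
  "exec F (Load x a) s t s'"
  "exec F (Store a x) s t s'"
  "exec F (Lookup x u v t1 t2) s t s'"
  "exec F (Seq P Q) s t s'"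
  "exec F (IfLess x y P Q) s t s'"

inductive_cases exec_WhileE: "exec F (WhileLess x y P) s t s'"

text \<open>
  Execution is deterministic, so the existence of one halting run with given time and output
  characterises the behaviour of a program.
\<close>

lemma exec_deterministic:
  "exec F P s t s' \<Longrightarrow> exec F P s u s'' \<Longrightarrow> u = t \<and> s'' = s'"
proof (induction arbitrary: u s'' rule: exec.induct)
  case (Seq P s t s' Q t' s3)
  from Seq.prems obtain t1 s1 t2 where
    *: "exec F P s t1 s1" "exec F Q s1 t2 s''" "u = t1 + t2"
    by (rule exec_elims(8))
  from Seq.IH(1)[OF *(1)] * have "exec F Q s' t2 s''" "u = t + t2" by auto
  from Seq.IH(2)[OF this(1)] this(2) show ?case by auto
next
  case (WhileFalse r x y P m)
  then show ?case by (auto elim: exec_WhileE)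
next
  case (WhileTrue r x y P m t s' t' s3)
  from WhileTrue.prems WhileTrue.hyps(1) obtain t1 s1 t2 where
    *: "exec F P (r, m) t1 s1" "exec F (WhileLess x y P) s1 t2 s''" "u = 1 + t1 + t2"
    by (cases rule: exec_WhileE) auto
  from WhileTrue.IH(1)[OF *(1)] * have "exec F (WhileLess x y P) s' t2 s''" "u = 1 + t + t2"
    by auto
  from WhileTrue.IH(2)[OF this(1)] this(2) show ?case by auto
next
  case (IfTrue r x y P m t s' Q)
  from IfTrue.prems IfTrue.hyps(1) obtain t1 where
    *: "exec F P (r, m) t1 s''" "u = 1 + t1"
    by (cases rule: exec_elims(9)) auto
  from IfTrue.IH[OF *(1)] *(2) show ?case by auto
next
  case (IfFalse r x y Q m t s' P)
  from IfFalse.prems IfFalse.hyps(1) obtain t1 where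
    *: "exec F Q (r, m) t1 s''" "u = 1 + t1"
    by (cases rule: exec_elims(9)) auto
  from IfFalse.IH[OF *(1)] *(2) show ?case by auto
qed (auto elim: exec_elims)

text \<open>
  Vertices are given by their numbers. All other registers and the whole memory are initially
  zero.
\<close>

definition input_state :: "nat \<Rightarrow> nat \<Rightarrow> nat \<Rightarrow> nat \<Rightarrow> nat \<Rightarrow> nat \<Rightarrow> state" where
  "input_state n T vs vt k f =
     ((\<lambda>_. 0)(''n'' := n, ''T'' := T, ''vs'' := vs, ''vt'' := vt, ''k'' := k, ''f'' := f), \<lambda>_. 0)"

definition decides_within ::
    "nat cost_fun \<Rightarrow> com \<Rightarrow> state \<Rightarrow> bool \<Rightarrow> nat \<Rightarrow> bool" where
  "decides_within F P s answer N \<longleftrightarrow>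
     (\<exists>t r m. exec F P s t (r, m) \<and> t \<le> N \<and> r ''out'' = of_bool answer)"

end

theory Submission
  imports Defs
begin

text \<open>
  A step between distinct vertices uses up one of the incident triples of both its ends. A walk
  enters a vertex other than its source and sink as often as it leaves it, so three triples allow
  only one entry. Hence the number of distinct vertices is the number of entries into such vertices,
  plus the number of endpoints, and a dynamic program need not remember which vertices were visited:
  its states are the time, the current vertex and the number of entries still required.
\<close>

section \<open>Walks and the affordability relation\<close>

text \<open>Valid walks may idle for free between steps. The relation \<open>afford\<close> instead
  always departs at the current time and treats idling as a self-step of cost 0, so a state needs no
  separate earliest departure. Recording the expense so far, and not the cost still to come, makes
  the affordable expenses of a state an initial segment of the naturals, which a single number
  stores. There are \<open>T * n * k\<close> states with at most \<open>T * n\<close> successors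
  each, so about \<open>n^2 * T^2 * k\<close> table accesses. The machine has no multiplication, so
  addresses cannot be computed from coordinates. The table is laid out in the order in which it is
  filled, latest time first: writing is sequential, and the successors of a cell are read with a
  pointer that only moves forward.\<close>

lemma all_nat_split: "(\<forall>i. P i) \<longleftrightarrow> P 0 \<and> (\<forall>i. P (Suc i))" for P :: "nat \<Rightarrow> bool"
  by (metis nat.exhaust)

lemma distinct_if_filter_le_1:
  assumes "\<And>x. length (filter (\<lambda>y. y = x) xs) \<le> 1"
  shows "distinct xs"
  using assms
proof (induction xs)
  case (Cons a xs)
  have "length (filter (\<lambda>y. y = a) xs) = 0"
    using Cons.prems[of a] by simp
  moreover have "length (filter (\<lambda>y. y = x) xs) \<le> 1" for x
    using Cons.prems[of x] by (simp split: if_splits)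
  ultimately show ?case
    using Cons.IH by (auto simp: filter_empty_conv)
qed simp

text \<open>Arrivals at the endpoints are left out because flow is unbalanced there: if source and
  sink differ, three triples still let a walk return once to the source, or enter the sink
  twice.\<close>

fun counts :: "'v \<Rightarrow> 'v \<Rightarrow> 'v step \<Rightarrow> bool" where
  "counts vs vt (u, v, _) \<longleftrightarrow> v \<noteq> u \<and> v \<noteq> vs \<and> v \<noteq> vt"

fun target :: "'v step \<Rightarrow> 'v" where
  "target (u, v, _) = v"

section \<open>Walks with a release time\<close>

locale orienteering_instance =
  fixes V :: "'v set" and E T and F :: "'v cost_fun" and vs vt :: 'v and k f :: nat
  assumes graph: "temporal_cost_graph V E T F"
    and lifetime: "has_lifetime V T F"
    and degree: "\<And>v. v \<in> V \<Longrightarrow> card (incident_triples V T F v) \<le> 3"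
    and source: "vs \<in> V"
begin

fun journey :: "nat \<Rightarrow> 'v \<Rightarrow> 'v step list \<Rightarrow> 'v \<Rightarrow> bool" where
  "journey t u [] v \<longleftrightarrow> u = v"
| "journey t u ((a, b, t1, t2) # w) v \<longleftrightarrow>
     a = u \<and> t \<le> t1 \<and> step_ok V T F (a, b, t1, t2) \<and> journey t2 b w v"

definition gain :: "'v step list \<Rightarrow> nat" where
  "gain w = length (filter (counts vs vt) w)"

lemma finite_V: "finite V"
  using graph by (simp add: temporal_cost_graph_def)

text \<open>The lifetime is attained by a finite arrival, whose departure is strictly earlier. This
  leaves room for a waiting step from time 1 to time 2.\<close>

lemma T_ge_2: "2 \<le> T"
proof -
  obtain v u t where *: "v \<in> V" "u \<in> V" "t \<in> {1..T}" "F v u t T < \<infinity>"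
    using lifetime by (auto simp: has_lifetime_def arrival_times_def)
  moreover have "t < T"
  proof (rule ccontr)
    assume "\<not> t < T"
    then have "F v u t T = \<infinity>"
      using * graph by (auto simp: temporal_cost_graph_def)
    with *(4) show False by simp
  qed
  ultimately show ?thesis by auto
qed

lemma wait_cost: "v \<in> V \<Longrightarrow> 1 \<le> t1 \<Longrightarrow> t1 < t2 \<Longrightarrow> t2 \<le> T \<Longrightarrow> F v v t1 t2 = 0"
  using graph by (auto simp: temporal_cost_graph_def)

lemma valid_walk_Cons:
  "valid_walk V T F (x # w) \<longleftrightarrow>
     step_ok V T F x \<and> (w = [] \<or> valid_walk V T F w \<and> consecutive x (hd w))"
proof (cases w)
  case (Cons y ys)
  then show ?thesis
    unfolding valid_walk_def by (subst all_nat_split) auto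
qed (simp add: valid_walk_def)

lemma journey_iff_valid_walk:
  assumes "w \<noteq> []"
  shows "journey t u w v \<longleftrightarrow> valid_walk V T F w \<and> walk_source w = u \<and> walk_sink w = v
    \<and> t \<le> fst (snd (snd (hd w)))"
  using assms
proof (induction w arbitrary: t u)
  case (Cons x w)
  obtain a b t1 t2 where x: "x = (a, b, t1, t2)" by (cases x)
  show ?case
  proof (cases "w = []")
    case True
    then show ?thesis by (auto simp: x valid_walk_def walk_source_def walk_sink_def)
  next
    case False
    obtain c d t3 t4 where "hd w = (c, d, t3, t4)" by (cases "hd w")
    with False Cons.IH[OF False, of t2 b] show ?thesis
      by (auto simp: x valid_walk_Cons walk_source_def walk_sink_def)
  qed
qed simp

text \<open>Every step takes positive time. Strictness is what later tells the steps of a walk apart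
  by their departure times.\<close>

lemma journey_departures:
  "journey t u w v \<Longrightarrow> sorted_wrt (<) (map (\<lambda>(_, _, t1, _). t1) w) \<and> (\<forall>(_, _, t1, _) \<in> set w. t \<le> t1)"
  by (induction t u w v rule: journey.induct) fastforce+

lemma journey_steps: "journey t u w v \<Longrightarrow> x \<in> set w \<Longrightarrow> step_ok V T F x"
  by (induction t u w v rule: journey.induct) auto

section \<open>Flow and degree at a single vertex\<close>

definition arrivals :: "'v \<Rightarrow> 'v step list \<Rightarrow> 'v step list" where
  "arrivals x w = filter (\<lambda>(u, v, _). u \<noteq> v \<and> v = x) w"

definition departures :: "'v \<Rightarrow> 'v step list \<Rightarrow> 'v step list" where
  "departures x w = filter (\<lambda>(u, v, _). u \<noteq> v \<and> u = x) w"

text \<open>Flow conservation: starting at \<open>u\<close> acts as an extra arrival, ending at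
  \<open>v\<close> as an extra departure. Self-steps contribute to neither count.\<close>

lemma journey_flow:
  "journey t u w v \<Longrightarrow>
     length (arrivals x w) + of_bool (u = x) = length (departures x w) + of_bool (v = x)"
  by (induction t u w v rule: journey.induct) (auto simp: arrivals_def departures_def)

lemma finite_incident_triples: "finite (incident_triples V T F x)"
  by (rule finite_subset[of _ "V \<times> {1..T} \<times> {1..T}"])
    (auto simp: incident_triples_def finite_V)

text \<open>A triple does not record its direction, so opposite steps could share one. Within a walk
  this cannot happen: the triple contains the departure time, which determines the step.\<close>

lemma arrivals_plus_departures:
  assumes j: "journey t u w v" and x: "x \<in> V"
  shows "length (arrivals x w) + length (departures x w) \<le> 3"
proof -
  define other :: "'v step \<Rightarrow> 'v \<times> nat \<times> nat" where
    "other = (\<lambda>(u, v, t1, t2). (if v = x then u else v, t1, t2))"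
  define P :: "'v step \<Rightarrow> bool" where "P = (\<lambda>(u, v, _). u \<noteq> v \<and> (u = x \<or> v = x))"
  have "length (arrivals x w) + length (departures x w) = length (filter P w)"
    unfolding arrivals_def departures_def P_def by (induction w) auto
  also have "\<dots> = card (set (map other (filter P w)))"
  proof -
    have "sorted_wrt (<) (map (\<lambda>(_, _, t1, _). t1) (filter P w))"
      using journey_departures[OF j] by (simp add: sorted_wrt_filter sorted_wrt_map)
    then have "distinct (map (\<lambda>(_, _, t1, _). t1) (filter P w))"
      by (simp add: strict_sorted_iff)
    moreover have "map (\<lambda>(_, _, t1, _). t1) (filter P w)
        = map (\<lambda>(_, t1, _). t1) (map other (filter P w))"
      by (auto simp: other_def)
    ultimately have "distinct (map other (filter P w))"
      by (metis distinct_map)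
    then show ?thesis
      by (metis distinct_card length_map)
  qed
  also have "\<dots> \<le> card (incident_triples V T F x)"
  proof (rule card_mono[OF finite_incident_triples], rule subsetI)
    fix e
    assume "e \<in> set (map other (filter P w))"
    then obtain y where y: "y \<in> set w" "P y" "e = other y" by auto
    with journey_steps[OF j y(1)] show "e \<in> incident_triples V T F x"
      by (cases y) (auto simp: P_def other_def incident_triples_def)
  qed
  also have "\<dots> \<le> 3"
    using degree[OF x] .
  finally show ?thesis .
qed

lemma inner_arrival_unique:
  assumes j: "journey t vs w vt" and x: "x \<noteq> vs" "x \<noteq> vt"
  shows "length (arrivals x w) \<le> 1"
proof (cases "x \<in> V")
  case True
  with arrivals_plus_departures[OF j] journey_flow[OF j, of x] x show ?thesis by fastforce
next
  case False
  then have "arrivals x w = []"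
    using journey_steps[OF j] by (auto simp: arrivals_def filter_empty_conv)
  then show ?thesis by simp
qed

lemma distinct_counted_targets:
  assumes "journey t vs w vt"
  shows "distinct (map target (filter (counts vs vt) w))"
proof (rule distinct_if_filter_le_1)
  fix x
  have "filter (\<lambda>y. y = x) (map target (filter (counts vs vt) w))
      = (if x = vs \<or> x = vt then [] else map target (arrivals x w))"
    unfolding arrivals_def by (induction w) auto
  with inner_arrival_unique[OF assms, of x]
  show "length (filter (\<lambda>y. y = x) (map target (filter (counts vs vt) w))) \<le> 1" by auto
qed

lemma visited_subset:
  "journey t u w v \<Longrightarrow> visited w \<subseteq> {u, vs, vt} \<union> target ` set (filter (counts vs vt) w)"
  by (induction t u w v rule: journey.induct) (auto simp: visited_def split: if_splits)

lemma endpoints_visited: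
  assumes "journey t u w v" "w \<noteq> []"
  shows "u \<in> visited w" "v \<in> visited w"
proof -
  have "walk_source w = u" "walk_sink w = v"
    using assms journey_iff_valid_walk by auto
  then show "u \<in> visited w" "v \<in> visited w"
    using hd_in_set[OF assms(2)] last_in_set[OF assms(2)]
    by (force simp: visited_def walk_source_def walk_sink_def split: prod.splits)+
qed

text \<open>The bound from above is plain covering by \<open>visited_subset\<close>. The bound from
  below is where the degree condition acts: a vertex entered twice would be counted twice by
  \<open>gain\<close>.\<close>

lemma card_visited:
  assumes j: "journey t vs w vt" and w: "w \<noteq> []"
  shows "card (visited w) = card {vs, vt} + gain w"
proof -
  let ?C = "target ` set (filter (counts vs vt) w)"
  have "?C \<subseteq> visited w" by (force simp: visited_def)
  then have "visited w = {vs, vt} \<union> ?C"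
    using visited_subset[OF j] endpoints_visited[OF j w] by auto
  moreover have "{vs, vt} \<inter> ?C = {}" by auto
  moreover have "card ?C = gain w"
    using distinct_card[OF distinct_counted_targets[OF j]] by (simp add: gain_def)
  ultimately show ?thesis
    using card_Un_disjoint[of "{vs, vt}" ?C] by simp
qed

text \<open>
  \<open>afford t u j x\<close>: after spending \<open>x\<close>, a walker at \<open>u\<close> at time \<open>t\<close> can still reach \<open>vt\<close> within
  the budget with at least \<open>j\<close> counted steps to go.
\<close>

inductive afford :: "nat \<Rightarrow> 'v \<Rightarrow> nat \<Rightarrow> nat \<Rightarrow> bool" where
  stop: "x \<le> f \<Longrightarrow> afford t vt 0 x"
| move: "F u v t t2 = enat c \<Longrightarrow> t < t2 \<Longrightarrow> t2 \<le> T \<Longrightarrow> v \<in> V \<Longrightarrow>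
    afford t2 v (j - of_bool (counts vs vt (u, v, t, t2))) (x + c) \<Longrightarrow> afford t u j x"

section \<open>Affordability characterises orienteering\<close>

lemma walk_cost_Cons [simp]:
  "walk_cost F ((u, v, t1, t2) # w) = F u v t1 t2 + walk_cost F w"
  by (simp add: walk_cost_def)

lemma afford_imp_journey:
  assumes "afford t u j x" "1 \<le> t" "u \<in> V"
  shows "\<exists>w. journey t u w vt \<and> j \<le> gain w \<and> walk_cost F w + enat x \<le> enat f"
  using assms
proof induction
  case (stop x t)
  then show ?case
    by (intro exI[of _ "[]"]) (simp add: gain_def walk_cost_def zero_enat_def)
next
  case (move u v t t2 c j x)
  then obtain w where w: "journey t2 v w vt"
    "j - of_bool (counts vs vt (u, v, t, t2)) \<le> gain w" "walk_cost F w + enat (x + c) \<le> enat f"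
    by auto
  have "walk_cost F ((u, v, t, t2) # w) + enat x \<le> enat f"
    using w(3) move.hyps(1) by (cases "walk_cost F w") (auto simp: ac_simps)
  \<comment> \<open>Truncated subtraction forgets surplus counted steps, hence an inequality and not
    an equality for \<open>gain\<close>.\<close>
  moreover have "j \<le> gain ((u, v, t, t2) # w)"
    using w(2) by (auto simp: gain_def split: if_splits)
  moreover have "journey t u ((u, v, t, t2) # w) vt"
    using w(1) move by simp
  ultimately show ?case by blast
qed

lemma journey_imp_afford:
  assumes "journey t u w vt" "j \<le> gain w" "walk_cost F w + enat x \<le> enat f" "1 \<le> t" "u \<in> V"
  shows "afford t u j x"
  using assms
proof (induction w arbitrary: t u j x)
  case Nil
  then show ?case by (auto simp: gain_def walk_cost_def zero_enat_def intro: stop)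
next
  case (Cons e w)
  obtain a b t1 t2 where e: "e = (a, b, t1, t2)" by (cases e)
  let ?d = "of_bool (counts vs vt (a, b, t1, t2))"
  from Cons.prems e have step: "a = u" "t \<le> t1" "b \<in> V" "t1 < t2" "t2 \<le> T" "F u b t1 t2 < \<infinity>"
    and w: "journey t2 b w vt" by auto
  then obtain c where c: "F u b t1 t2 = enat c" by auto
  have "walk_cost F w + enat (x + c) \<le> enat f"
    using Cons.prems(3) c by (cases "walk_cost F w") (auto simp: e step(1) ac_simps)
  moreover have "j - ?d \<le> gain w"
    using Cons.prems(2) e by (auto simp: gain_def split: if_splits)
  ultimately have "afford t2 b (j - ?d) (x + c)"
    using Cons.IH[OF w] Cons.prems step by auto
  then have 1: "afford t1 u j x"
    using c step by (auto intro: move)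
  show ?case
  proof (cases "t = t1")
    \<comment> \<open>The idle time before \<open>t1\<close> is bridged by a self-step at
      \<open>u\<close> from \<open>t\<close> to \<open>t1\<close>, which is free and not
      counted.\<close>
    case False
    then show ?thesis
      using 1 step Cons.prems(4,5) wait_cost[of u t t1]
      by (intro move[of u u t t1 0]) (auto simp: zero_enat_def)
  qed (use 1 in simp)
qed

text \<open>Every nonempty walk between the endpoints visits both of them, so they are deducted from
  \<open>k\<close> in advance, and truncation at 0 loses nothing.\<close>

lemma orienteering_iff_afford:
  "orienteering V T F vs vt k f \<longleftrightarrow> afford 1 vs (k - card {vs, vt}) 0"
proof
  assume "orienteering V T F vs vt k f"
  then obtain w where w: "valid_walk V T F w" "walk_source w = vs" "walk_sink w = vt"
    "k \<le> card (visited w)" "walk_cost F w \<le> enat f"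
    by (auto simp: orienteering_def)
  then have ne: "w \<noteq> []" by (simp add: valid_walk_def)
  then have "step_ok V T F (hd w)" using w(1) by (simp add: valid_walk_def)
  then have "1 \<le> fst (snd (snd (hd w)))" by (cases "hd w") auto
  then have j: "journey 1 vs w vt"
    using w ne by (simp add: journey_iff_valid_walk)
  show "afford 1 vs (k - card {vs, vt}) 0"
    using journey_imp_afford[OF j] card_visited[OF j ne] w source
    by (auto simp flip: zero_enat_def)
next
  assume "afford 1 vs (k - card {vs, vt}) 0"
  then obtain w where w: "journey 1 vs w vt" "k - card {vs, vt} \<le> gain w" "walk_cost F w \<le> enat f"
    using afford_imp_journey source by (force simp flip: zero_enat_def)
  have "\<exists>w. w \<noteq> [] \<and> journey 1 vs w vt \<and> k - card {vs, vt} \<le> gain w \<and> walk_cost F w \<le> enat f"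
  proof (cases "w = []")
    case True
    \<comment> \<open>A valid walk is nonempty, so an empty journey is replaced by waiting for one
      time unit, which changes neither cost nor gain.\<close>
    have "F vs vs 1 2 = 0" using wait_cost[of vs 1 2] source T_ge_2 by simp
    moreover have "gain [(vs, vs, 1, 2)] = gain w"
      using True by (simp add: gain_def)
    moreover have "vs = vt"
      using w(1) True by simp
    ultimately show ?thesis
      using True w source T_ge_2 by (intro exI[of _ "[(vs, vs, 1, 2)]"]) auto
  qed (use w in blast)
  then obtain w where "w \<noteq> []" "journey 1 vs w vt" "k - card {vs, vt} \<le> gain w"
    "walk_cost F w \<le> enat f" by blast
  then show "orienteering V T F vs vt k f"
    using card_visited[of 1 w] journey_iff_valid_walk[of w 1 vs vt]
    by (auto simp: orienteering_def intro!: exI[of _ w])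
qed

end

section \<open>Running time of structured programs\<close>

text \<open>A total-correctness triple with a time bound. As only an upper bound is asked for,
  branches of different length need no exact accounting.\<close>

definition terminates ::
    "nat cost_fun \<Rightarrow> com \<Rightarrow> state \<Rightarrow> nat \<Rightarrow> (state \<Rightarrow> bool) \<Rightarrow> bool" where
  "terminates F P s N Q \<longleftrightarrow> (\<exists>t s'. exec F P s t s' \<and> t \<le> N \<and> Q s')"

lemma terminates_mono:
  "terminates F P s M Q \<Longrightarrow> M \<le> N \<Longrightarrow> (\<And>s. Q s \<Longrightarrow> R s) \<Longrightarrow> terminates F P s N R"
  unfolding terminates_def by (meson le_trans)

lemma terminates_Seq:
  "terminates F P s a (\<lambda>s'. terminates F Q s' b R) \<Longrightarrow> a + b \<le> N \<Longrightarrow> terminates F (Seq P Q) s N R"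
  unfolding terminates_def by (meson Seq add_mono le_trans)

text \<open>The invariant is indexed by the number of completed rounds, known in advance for every
  loop here. Each round pays one test, and the final failing test gives the last
  \<open>+ 1\<close>.\<close>

lemma terminates_While:
  assumes "I 0 s"
    and step: "\<And>i r m. i < N \<Longrightarrow> I i (r, m) \<Longrightarrow>
      r x < r y \<and> terminates F P (r, m) b (I (Suc i))"
    and exit: "\<And>r m. I N (r, m) \<Longrightarrow> \<not> r x < r y"
  shows "terminates F (WhileLess x y P) s (N * (b + 1) + 1) (I N)"
proof -
  have "I i s \<Longrightarrow> i \<le> N \<Longrightarrow>
      terminates F (WhileLess x y P) s ((N - i) * (b + 1) + 1) (I N)" for i s
  proof (induction "N - i" arbitrary: i s)
    case 0
    obtain r m where "s = (r, m)" by (cases s)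
    with 0 exit[of r m] show ?case
      by (auto simp: terminates_def intro!: exI exec.WhileFalse)
  next
    case (Suc d)
    obtain r m where s: "s = (r, m)" by (cases s)
    have "i < N" using Suc.hyps(2) by simp
    with Suc.prems(1) step[of i r m] obtain t s' where
      1: "r x < r y" "exec F P (r, m) t s'" "t \<le> b" "I (Suc i) s'"
      unfolding terminates_def s by blast
    have "d = N - Suc i" using Suc.hyps(2) by simp
    with Suc.hyps(1)[of "Suc i" s'] \<open>i < N\<close> 1(4) obtain t' s'' where
      2: "exec F (WhileLess x y P) s' t' s''" "t' \<le> d * (b + 1) + 1" "I N s''"
      unfolding terminates_def by auto
    have "exec F (WhileLess x y P) s (1 + t + t') s''"
      unfolding s using 1 2 by (intro exec.WhileTrue)
    moreover have "1 + t + t' \<le> (N - i) * (b + 1) + 1"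
      using 1(3) 2(2) by (simp flip: Suc.hyps(2))
    ultimately show ?case
      using 2(3) unfolding terminates_def by blast
  qed
  from this[of 0] assms(1) show ?thesis by simp
qed

fun loop_free :: "com \<Rightarrow> bool" where
  "loop_free (Seq P Q) \<longleftrightarrow> loop_free P \<and> loop_free Q"
| "loop_free (IfLess x y P Q) \<longleftrightarrow> loop_free P \<and> loop_free Q"
| "loop_free (WhileLess x y P) \<longleftrightarrow> False"
| "loop_free _ \<longleftrightarrow> True"

fun duration :: "com \<Rightarrow> nat" where
  "duration (Seq P Q) = duration P + duration Q"
| "duration (IfLess x y P Q) = 1 + max (duration P) (duration Q)"
| "duration _ = 1"

text \<open>The value on a loop is a dummy.\<close>

fun result :: "nat cost_fun \<Rightarrow> com \<Rightarrow> state \<Rightarrow> state" where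
  "result F Skip s = s"
| "result F (Const x c) (r, m) = (r(x := c), m)"
| "result F (Add x y z) (r, m) = (r(x := r y + r z), m)"
| "result F (Sub x y z) (r, m) = (r(x := r y - r z), m)"
| "result F (Load x a) (r, m) = (r(x := m (r a)), m)"
| "result F (Store a x) (r, m) = (r, m(r a := r x))"
| "result F (Lookup x u v t1 t2) (r, m) =
     (r(x := cost_code (F (r u) (r v) (r t1) (r t2))), m)"
| "result F (Seq P Q) s = result F Q (result F P s)"
| "result F (IfLess x y P Q) (r, m) = (if r x < r y then result F P (r, m) else result F Q (r, m))"
| "result F (WhileLess x y P) s = s"

text \<open>Reduces straight-line and branching code to evaluation of \<open>result\<close>, which
  the simplifier performs; only loops then need invariants.\<close>

lemma terminates_result:
  "loop_free P \<Longrightarrow> terminates F P s (duration P) (\<lambda>s'. s' = result F P s)"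
proof (induction P arbitrary: s)
  case (Seq P Q)
  then have "terminates F P s (duration P) (\<lambda>s'. s' = result F P s)"
    "terminates F Q (result F P s) (duration Q) (\<lambda>s'. s' = result F Q (result F P s))" by auto
  then show ?case
    by (intro terminates_Seq[where a = "duration P" and b = "duration Q"]) (auto elim: terminates_mono)
next
  case (IfLess x y P Q)
  obtain r m where s: "s = (r, m)" by (cases s)
  show ?case
  proof (cases "r x < r y")
    case True
    with IfLess.IH(1)[of s] IfLess.prems obtain t where "exec F P s t (result F P s)" "t \<le> duration P"
      by (auto simp: terminates_def)
    with True show ?thesis
      unfolding terminates_def s
      by (intro exI[of _ "1 + t"] exI[of _ "result F P s"]) (auto simp: s intro: exec.IfTrue[simplified])
  next
    case False
    with IfLess.IH(2)[of s] IfLess.prems obtain t where "exec F Q s t (result F Q s)" "t \<le> duration Q"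
      by (auto simp: terminates_def)
    with False show ?thesis
      unfolding terminates_def s
      by (intro exI[of _ "1 + t"] exI[of _ "result F Q s"]) (auto simp: s intro: exec.IfFalse[simplified])
  qed
qed (auto simp: terminates_def split: prod.splits
  intro!: exec.Skip[simplified] exec.Const[simplified] exec.Add[simplified] exec.Sub[simplified]
    exec.Load[simplified] exec.Store[simplified] exec.Lookup[simplified])

lemma terminates_loop_free:
  "loop_free P \<Longrightarrow> duration P \<le> N \<Longrightarrow> Q (result F P s) \<Longrightarrow> terminates F P s N Q"
  by (auto intro: terminates_mono[OF terminates_result])


lemma terminates_prefix:
  assumes "loop_free P" "duration P \<le> a" "terminates F Q (result F P s) b R" "a + b \<le> N"
  shows "terminates F (Seq P Q) s N R"
  using terminates_Seq[OF terminates_loop_free[of P a] assms(4)] assms(1-3) by blast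


section \<open>The program\<close>

notation Seq (infixr ";;" 60)

abbreviation IfEq :: "reg \<Rightarrow> reg \<Rightarrow> com \<Rightarrow> com \<Rightarrow> com" where
  "IfEq x y P Q \<equiv> IfLess x y Q (IfLess y x Q P)"

text \<open>
  Table entries and the register \<open>best\<close> hold the number of affordable prior expenses, that is,
  the budget plus one minus the least cost of a continuation, truncated at 0. So impossibility is 0,
  as in the initial memory, and optimal costs become maxima.
\<close>

definition remaining_need :: com where
  "remaining_need =
     IfEq ''v'' ''u'' (Add ''a'' ''j'' ''zero'')
       (IfEq ''v'' ''vs'' (Add ''a'' ''j'' ''zero'')
         (IfEq ''v'' ''vt'' (Add ''a'' ''j'' ''zero'') (Sub ''a'' ''j'' ''one'')))"

text \<open>\<open>cost_code\<close> is 0 for an infinite cost and one too large for a finite one;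
  adding \<open>one\<close> before subtracting \<open>c\<close> corrects the shift. Adding
  \<open>k\<close> moves \<open>p\<close> to the row of the next vertex.\<close>

definition relax_step :: com where
  "relax_step =
     Lookup ''c'' ''u'' ''v'' ''t'' ''t2'' ;;
     IfLess ''zero'' ''c''
       (remaining_need ;;
        Add ''a'' ''p'' ''a'' ;; Load ''a'' ''a'' ;;
        Add ''a'' ''a'' ''one'' ;; Sub ''a'' ''a'' ''c'' ;;
        IfLess ''best'' ''a'' (Add ''best'' ''a'' ''zero'') Skip)
       Skip ;;
     Add ''p'' ''p'' ''k'' ;;
     Add ''v'' ''v'' ''one''"

text \<open>\<open>p\<close> is not reset between times: behind the last row of a layer lies the
  first row of the next.\<close>

definition relax_time :: com where
  "relax_time =
     Const ''v'' 0 ;;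
     WhileLess ''v'' ''n'' relax_step ;;
     Sub ''t2'' ''t2'' ''one'' ;;
     Add ''s2'' ''s2'' ''one''"

text \<open>The value \<open>b = f + 1\<close> is the number of expenses within the budget; it
  applies only where the walker may stop.\<close>

definition start_cell :: com where
  "start_cell =
     Const ''best'' 0 ;;
     IfEq ''u'' ''vt'' (IfLess ''j'' ''one'' (Add ''best'' ''b'' ''zero'') Skip) Skip ;;
     Const ''p'' 0 ;;
     Add ''t2'' ''T'' ''zero'' ;;
     Const ''s2'' 0"

definition finish_cell :: com where
  "finish_cell =
     Store ''q'' ''best'' ;;
     Add ''q'' ''q'' ''one'' ;;
     Add ''j'' ''j'' ''one''"

definition fill_cell :: com where
  "fill_cell = start_cell ;; WhileLess ''s2'' ''s'' relax_time ;; finish_cell"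

definition fill_vertex :: com where
  "fill_vertex = Const ''j'' 0 ;; WhileLess ''j'' ''k'' fill_cell ;; Add ''u'' ''u'' ''one''"

definition fill_time :: com where
  "fill_time =
     Const ''u'' 0 ;;
     WhileLess ''u'' ''n'' fill_vertex ;;
     Sub ''t'' ''t'' ''one'' ;;
     Add ''s'' ''s'' ''one''"

text \<open>\<open>g\<close> becomes \<open>k - card {vs, vt}\<close>. The registers
  \<open>zero\<close>, \<open>s\<close> and \<open>q\<close> rely on their initial value 0.\<close>

definition setup_registers :: com where
  "setup_registers =
     Const ''one'' 1 ;;
     Sub ''g'' ''k'' ''one'' ;;
     IfEq ''vs'' ''vt'' Skip (Sub ''g'' ''g'' ''one'') ;;
     Add ''t'' ''T'' ''zero'' ;;
     Add ''b'' ''f'' ''one''"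

text \<open>After filling, \<open>q\<close> points just behind the row of vertex
  \<open>n - 1\<close> at time 1. Counting \<open>vs\<close> up to \<open>n\<close> while stepping
  back one row at a time lands on the row of the source without a multiplication.\<close>

definition rewind :: com where
  "rewind = Sub ''q'' ''q'' ''k'' ;; Add ''vs'' ''vs'' ''one''"

definition read_answer :: com where
  "read_answer =
     Add ''a'' ''q'' ''g'' ;; Load ''a'' ''a'' ;;
     IfLess ''zero'' ''a'' (Const ''out'' 1) (Const ''out'' 0)"

definition orienteering_program :: com where
  "orienteering_program =
     setup_registers ;;
     WhileLess ''s'' ''T'' fill_time ;;
     WhileLess ''vs'' ''n'' rewind ;;
     read_answer"


section \<open>Correctness of the program\<close>

locale numbered_instance =
  orienteering_instance "{0..<n}" E T F vs vt k f for n :: nat and E T F vs vt k f +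
  assumes sink: "vt < n" and k_pos: "1 \<le> k"
begin

section \<open>Addresses and contents of the table\<close>

lemma vs_less: "vs < n"
  using source by simp

text \<open>In the program \<open>s = T - t\<close> is the time left at time \<open>t\<close>.\<close>

definition cell :: "nat \<Rightarrow> nat \<Rightarrow> nat \<Rightarrow> nat" where
  "cell s u j = (s * n + u) * k + j"

lemma cell_row_end: "cell s u k = cell s (Suc u) 0"
  by (simp add: cell_def)

lemma cell_layer_end: "cell s n 0 = cell (Suc s) 0 0"
  by (simp add: cell_def)

lemma cell_Suc: "cell s u (Suc j) = Suc (cell s u j)"
  by (simp add: cell_def)

lemma cell_eq_iff:
  assumes "u < n" "u' < n" "j < k" "j' < k"
  shows "cell s u j = cell s' u' j' \<longleftrightarrow> s = s' \<and> u = u' \<and> j = j'"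
proof -
  have digits: "a * b + c = a' * b + c' \<longleftrightarrow> a = a' \<and> c = c'" if "c < b" "c' < b" for a b c a' c' :: nat
  proof -
    have "(a * b + c) div b = a" "(a' * b + c') div b = a'" using that by auto
    then show ?thesis by (metis add_left_cancel)
  qed
  show ?thesis
    unfolding cell_def using assms by (simp add: digits)
qed

text \<open>Guarantees that a scan reads only finished entries: it looks at layers
  \<open>s2 < s\<close>, which lie entirely before the cell being filled.\<close>

lemma cell_less_layer:
  assumes "s < s'" "u < n" "j < k"
  shows "cell s u j < cell s' u' j'"
proof -
  have "cell s u j < (s * n + u) * k + k"
    using assms(3) by (simp add: cell_def)
  also have "\<dots> = (s * n + Suc u) * k" by simp
  also have "\<dots> \<le> (s * n + n) * k"
    using assms(2) by (intro mult_right_mono) auto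
  also have "\<dots> = Suc s * n * k" by simp
  also have "\<dots> \<le> s' * n * k"
    using assms(1) by (intro mult_right_mono) auto
  also have "\<dots> \<le> cell s' u' j'" by (simp add: cell_def algebra_simps)
  finally show ?thesis .
qed

text \<open>Here \<open>q\<close> is the next address to be written. The equivalence for all
  \<open>x\<close> determines each entry, so no minimum over walks has to be defined.\<close>

definition table :: "(nat \<Rightarrow> nat) \<Rightarrow> nat \<Rightarrow> bool" where
  "table m q \<longleftrightarrow> (\<forall>s u j x. s < T \<longrightarrow> u < n \<longrightarrow> j < k \<longrightarrow> cell s u j < q \<longrightarrow>
     (x < m (cell s u j) \<longleftrightarrow> afford (T - s) u j x))"

lemma table_update:
  assumes "table m (cell s u j)" "u < n" "j < k" "\<And>x. x < y \<longleftrightarrow> afford (T - s) u j x"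
  shows "table (m(cell s u j := y)) (Suc (cell s u j))"
  using assms unfolding table_def by (auto simp: less_Suc_eq cell_eq_iff)

section \<open>Progress of a scan over successors\<close>

definition via :: "nat \<Rightarrow> nat \<Rightarrow> nat \<Rightarrow> nat \<Rightarrow> nat \<Rightarrow> nat \<Rightarrow> bool" where
  "via s u j s' v x \<longleftrightarrow> (\<exists>c. F u v (T - s) (T - s') = enat c \<and>
     afford (T - s') v (j - of_bool (v \<noteq> u \<and> v \<noteq> vs \<and> v \<noteq> vt)) (x + c))"

definition found :: "nat \<Rightarrow> nat \<Rightarrow> nat \<Rightarrow> nat \<Rightarrow> nat \<Rightarrow> nat \<Rightarrow> bool" where
  "found s u j s2 i x \<longleftrightarrow> u = vt \<and> j = 0 \<and> x \<le> f \<or>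
     (\<exists>s'<s2. \<exists>v<n. via s u j s' v x) \<or> (\<exists>v<i. via s u j s2 v x)"

lemma found_start: "found s u j 0 0 x \<longleftrightarrow> u = vt \<and> j = 0 \<and> x \<le> f"
  by (simp add: found_def)

lemma found_Suc: "found s u j s2 (Suc i) x \<longleftrightarrow> found s u j s2 i x \<or> via s u j s2 i x"
  by (auto simp: found_def less_Suc_eq)

lemma found_next: "found s u j (Suc s2) 0 x \<longleftrightarrow> found s u j s2 n x"
  by (auto simp: found_def less_Suc_eq)

text \<open>A completed scan is one unfolding of \<open>afford\<close>: the arrival times after
  \<open>T - s\<close> are exactly the \<open>T - s'\<close> with \<open>s' < s\<close>.\<close>

lemma found_all:
  assumes "s < T"
  shows "found s u j s 0 x \<longleftrightarrow> afford (T - s) u j x"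
proof
  assume "found s u j s 0 x"
  then consider "u = vt" "j = 0" "x \<le> f" | s' v where "s' < s" "v < n" "via s u j s' v x"
    unfolding found_def by blast
  then show "afford (T - s) u j x"
  proof cases
    case 1
    then show ?thesis by (simp add: afford.stop)
  next
    case 2
    then obtain c where "F u v (T - s) (T - s') = enat c"
      "afford (T - s') v (j - of_bool (counts vs vt (u, v, T - s, T - s'))) (x + c)"
      unfolding via_def by auto
    moreover have "T - s < T - s'" "v \<in> {0..<n}" using 2 assms by auto
    ultimately show ?thesis by (intro afford.move[of u v "T - s" "T - s'" c]) auto
  qed
next
  assume "afford (T - s) u j x"
  then show "found s u j s 0 x"
  proof cases
    case stop
    then show ?thesis by (simp add: found_def)
  next
    case (move v t2 c)
    have t2: "T - (T - t2) = t2" using move(3) by simp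
    have "via s u j (T - t2) v x"
      unfolding via_def t2 using move(1,5) by auto
    moreover have "T - t2 < s" "v < n"
      using move(2-4) assms by auto
    ultimately show ?thesis unfolding found_def by blast
  qed
qed

section \<open>Loop invariants\<close>

definition frame :: "(reg \<Rightarrow> nat) \<Rightarrow> bool" where
  "frame r \<longleftrightarrow> r ''n'' = n \<and> r ''T'' = T \<and> r ''vs'' = vs \<and> r ''vt'' = vt \<and> r ''k'' = k \<and>
     r ''zero'' = 0 \<and> r ''one'' = 1 \<and> r ''b'' = Suc f \<and> r ''g'' = k - card {vs, vt}"

definition at_time :: "nat \<Rightarrow> (reg \<Rightarrow> nat) \<Rightarrow> bool" where
  "at_time s r \<longleftrightarrow> frame r \<and> r ''t'' = T - s \<and> r ''s'' = s"

definition at_cell :: "nat \<Rightarrow> nat \<Rightarrow> nat \<Rightarrow> (reg \<Rightarrow> nat) \<Rightarrow> bool" where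
  "at_cell s u j r \<longleftrightarrow> at_time s r \<and> r ''u'' = u \<and> r ''j'' = j \<and> r ''q'' = cell s u j"

definition step_inv :: "nat \<Rightarrow> nat \<Rightarrow> nat \<Rightarrow> (nat \<Rightarrow> nat) \<Rightarrow> nat \<Rightarrow> nat \<Rightarrow> state \<Rightarrow> bool" where
  "step_inv s u j m s2 i = (\<lambda>(r, m'). m' = m \<and> at_cell s u j r \<and>
     r ''t2'' = T - s2 \<and> r ''s2'' = s2 \<and> r ''v'' = i \<and> r ''p'' = cell s2 i 0 \<and>
     (\<forall>x. x < r ''best'' \<longleftrightarrow> found s u j s2 i x))"

definition scan_inv :: "nat \<Rightarrow> nat \<Rightarrow> nat \<Rightarrow> (nat \<Rightarrow> nat) \<Rightarrow> nat \<Rightarrow> state \<Rightarrow> bool" where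
  "scan_inv s u j m s2 = (\<lambda>(r, m'). m' = m \<and> at_cell s u j r \<and>
     r ''t2'' = T - s2 \<and> r ''s2'' = s2 \<and> r ''p'' = cell s2 0 0 \<and>
     (\<forall>x. x < r ''best'' \<longleftrightarrow> found s u j s2 0 x))"

definition cell_inv :: "nat \<Rightarrow> nat \<Rightarrow> nat \<Rightarrow> state \<Rightarrow> bool" where
  "cell_inv s u j = (\<lambda>(r, m). at_cell s u j r \<and> table m (cell s u j))"

definition vertex_inv :: "nat \<Rightarrow> nat \<Rightarrow> state \<Rightarrow> bool" where
  "vertex_inv s u = (\<lambda>(r, m). at_time s r \<and> r ''u'' = u \<and> r ''q'' = cell s u 0 \<and>
     table m (cell s u 0))"

definition time_inv :: "nat \<Rightarrow> state \<Rightarrow> bool" where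
  "time_inv s = (\<lambda>(r, m). at_time s r \<and> r ''q'' = cell s 0 0 \<and> table m (cell s 0 0))"

definition rewind_inv :: "nat \<Rightarrow> state \<Rightarrow> bool" where
  "rewind_inv i = (\<lambda>(r, m). r ''vs'' = vs + i \<and> r ''n'' = n \<and> r ''k'' = k \<and> r ''one'' = 1 \<and>
     r ''zero'' = 0 \<and> r ''g'' = k - card {vs, vt} \<and>
     r ''q'' = cell (T - 1) (n - i) 0 \<and> table m (cell T 0 0))"

lemmas inv_defs = frame_def at_time_def at_cell_def step_inv_def scan_inv_def cell_inv_def
  vertex_inv_def time_inv_def rewind_inv_def

section \<open>Loop bodies and their running times\<close>

lemma result_remaining_need:
  assumes "r ''zero'' = 0" "r ''one'' = 1"
  shows "result F remaining_need (r, m) = (r(''a'' := r ''j'' -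
    of_bool (r ''v'' \<noteq> r ''u'' \<and> r ''v'' \<noteq> r ''vs'' \<and> r ''v'' \<noteq> r ''vt'')), m)"
  using assms by (simp add: remaining_need_def)

lemma relax_step_spec:
  assumes inv: "step_inv s u j m s2 i (r, m')" and tab: "table m (cell s u j)"
    and i: "i < n" and s2: "s2 < s" and s: "s < T" and j: "j < k"
  shows "terminates F relax_step (r, m') 20 (step_inv s u j m s2 (Suc i))"
proof -
  let ?c = "cost_code (F u i (T - s) (T - s2))"
  have regs: "r ''zero'' = 0" "r ''one'' = 1" "r ''u'' = u" "r ''v'' = i" "r ''t'' = T - s"
    "r ''t2'' = T - s2" "r ''j'' = j" "r ''vs'' = vs" "r ''vt'' = vt" "r ''k'' = k"
    "r ''p'' = cell s2 i 0" "m' = m"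
    using inv unfolding inv_defs by simp_all
  have old: "x < r ''best'' \<longleftrightarrow> found s u j s2 i x" for x
    using inv unfolding step_inv_def by simp
  let ?d = "j - of_bool (i \<noteq> u \<and> i \<noteq> vs \<and> i \<noteq> vt)"
  have d: "?d < k" using j by auto
  have entry: "x < m (cell s2 i ?d) \<longleftrightarrow> afford (T - s2) i ?d x" for x
    using tab i s2 s d cell_less_layer[OF s2 i d] unfolding table_def by simp
  have addr: "r ''p'' + ?d = cell s2 i ?d"
    by (simp add: regs cell_def)
  have p: "cell s2 i 0 + k = cell s2 (Suc i) 0"
    by (simp add: cell_def)
  \<comment> \<open>For a finite cost \<open>c\<close> this is the entry minus \<open>c\<close>, and
    \<open>x\<close> lies below it iff \<open>x + c\<close> lies below the entry.\<close>
  define a where "a = m (cell s2 i ?d) + 1 - cost_code (F u i (T - s) (T - s2))"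
  have via: "via s u j s2 i x \<longleftrightarrow> 0 < cost_code (F u i (T - s) (T - s2)) \<and> x < a" for x
    using entry by (cases "F u i (T - s) (T - s2)") (auto simp: via_def a_def less_diff_conv)
  \<comment> \<open>Being below a maximum is a disjunction, which matches the one in
    \<open>found_Suc\<close>.\<close>
  define b where "b = (if 0 < cost_code (F u i (T - s) (T - s2)) then max (r ''best'') a else r ''best'')"
  have best: "x < b \<longleftrightarrow> found s u j s2 (Suc i) x" for x
    unfolding found_Suc via b_def old[symmetric] by auto
  have loop_free: "loop_free relax_step" and time: "duration relax_step \<le> 20"
    by (simp_all add: relax_step_def remaining_need_def)
  \<comment> \<open>The scratch register \<open>a\<close> ends differently in the two branches. No
    invariant mentions it, so its value may stay existential.\<close>
  have "\<exists>a'. result F relax_step (r, m') = (r(''c'' := ?c, ''a'' := a',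
    ''best'' := b, ''p'' := cell s2 (Suc i) 0, ''v'' := Suc i), m)"
  proof (cases "0 < ?c")
    case True
    then show ?thesis
      using addr by (intro exI[of _ a])
        (simp add: relax_step_def result_remaining_need regs p b_def a_def max_def fun_eq_iff)
  next
    case False
    then show ?thesis
      by (intro exI[of _ "r ''a''"]) (simp add: relax_step_def regs p b_def fun_eq_iff)
  qed
  then obtain a' where res: "result F relax_step (r, m') = (r(''c'' := ?c, ''a'' := a',
    ''best'' := b, ''p'' := cell s2 (Suc i) 0, ''v'' := Suc i), m)" by blast
  have "step_inv s u j m s2 (Suc i) (result F relax_step (r, m'))"
    unfolding res using inv by (simp add: inv_defs best)
  then show ?thesis
    by (rule terminates_loop_free[OF loop_free time])
qed

lemma n_pos: "1 \<le> n"
  using vs_less by simp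

lemma relax_time_spec:
  assumes inv: "scan_inv s u j m s2 (r, m')" and tab: "table m (cell s u j)"
    and s2: "s2 < s" and s: "s < T" and j: "j < k"
  shows "terminates F relax_time (r, m') (25 * n) (scan_inv s u j m (Suc s2))"
  unfolding relax_time_def
proof (rule terminates_prefix[where a = 1 and b = "n * (20 + 1) + 1 + 2"])
  \<comment> \<open>The left side is \<open>21 * n + 4\<close>, and \<open>1 \<le> n\<close> absorbs
    the 4. The factors 40, 45 and 50 of the outer loops arise likewise from positive sizes, with
    some slack.\<close>
  show "1 + (n * (20 + 1) + 1 + 2) \<le> 25 * n" using n_pos by simp
  have start: "step_inv s u j m s2 0 (r(''v'' := 0), m')"
    using inv by (simp add: inv_defs)
  have loop: "terminates F (WhileLess ''v'' ''n'' relax_step) (r(''v'' := 0), m')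
      (n * (20 + 1) + 1) (step_inv s u j m s2 n)"
  proof (rule terminates_While[where I = "step_inv s u j m s2", OF start])
    fix i r m'
    assume i: "i < n" and inv': "step_inv s u j m s2 i (r, m')"
    have "r ''v'' < r ''n''"
      using i inv' by (simp add: inv_defs)
    then show "r ''v'' < r ''n'' \<and> terminates F relax_step (r, m') 20 (step_inv s u j m s2 (Suc i))"
      using relax_step_spec[OF inv' tab i s2 s j] by simp
  qed (simp add: inv_defs)
  have finish: "terminates F (Sub ''t2'' ''t2'' ''one'' ;; Add ''s2'' ''s2'' ''one'') x 2
      (scan_inv s u j m (Suc s2))" if x: "step_inv s u j m s2 n x" for x
  proof (rule terminates_loop_free)
    obtain r' m'' where "x = (r', m'')" by (cases x)
    with x show "scan_inv s u j m (Suc s2)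
        (result F (Sub ''t2'' ''t2'' ''one'' ;; Add ''s2'' ''s2'' ''one'') x)"
      by (simp add: inv_defs found_next cell_layer_end)
  qed simp_all
  have "terminates F (WhileLess ''v'' ''n'' relax_step ;; Sub ''t2'' ''t2'' ''one'' ;;
      Add ''s2'' ''s2'' ''one'') (r(''v'' := 0), m') (n * (20 + 1) + 1 + 2) (scan_inv s u j m (Suc s2))"
    by (rule terminates_Seq[OF terminates_mono[OF loop order_refl finish]]) simp_all
  then show "terminates F (WhileLess ''v'' ''n'' relax_step ;;
      Sub ''t2'' ''t2'' ''one'' ;; Add ''s2'' ''s2'' ''one'') (result F (Const ''v'' 0) (r, m'))
      (n * (20 + 1) + 1 + 2) (scan_inv s u j m (Suc s2))"
    by simp
qed simp_all

lemma result_start_cell: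
  assumes "at_cell s u j r"
  shows "result F start_cell (r, m) = (r(''best'' := if u = vt \<and> j = 0 then Suc f else 0,
    ''p'' := 0, ''t2'' := T, ''s2'' := 0), m)"
  using assms by (simp add: inv_defs start_cell_def fun_eq_iff)

lemma fill_cell_spec:
  assumes inv: "cell_inv s u j (r, m)" and s: "s < T" and u: "u < n" and j: "j < k"
  shows "terminates F fill_cell (r, m) (40 * (n * T)) (cell_inv s u (Suc j))"
  unfolding fill_cell_def
proof (rule terminates_prefix[where a = 8 and b = "s * (25 * n + 1) + 1 + 3"])
  have tab: "table m (cell s u j)" and at: "at_cell s u j r"
    using inv by (simp_all add: cell_inv_def)
  have "s * (25 * n + 1) \<le> T * (26 * n)"
    using s n_pos by (intro mult_mono) simp_all
  then have "s * (25 * n + 1) \<le> 26 * (n * T)" by (simp only: ac_simps)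
  moreover have "1 \<le> n * T"
    using n_pos s by simp
  ultimately show "8 + (s * (25 * n + 1) + 1 + 3) \<le> 40 * (n * T)"
    by linarith
  have start: "scan_inv s u j m 0 (result F start_cell (r, m))"
    unfolding result_start_cell[OF at] using at by (simp add: inv_defs found_start cell_def less_Suc_eq_le)
  have loop: "terminates F (WhileLess ''s2'' ''s'' relax_time) (result F start_cell (r, m))
      (s * (25 * n + 1) + 1) (scan_inv s u j m s)"
  proof (rule terminates_While[where I = "scan_inv s u j m", OF start])
    fix s2 r m'
    assume s2: "s2 < s" and inv': "scan_inv s u j m s2 (r, m')"
    have "r ''s2'' < r ''s''"
      using s2 inv' by (simp add: inv_defs)
    then show "r ''s2'' < r ''s'' \<and>
        terminates F relax_time (r, m') (25 * n) (scan_inv s u j m (Suc s2))"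
      using relax_time_spec[OF inv' tab s2 s j] by simp
  qed (simp add: inv_defs)
  have finish: "terminates F finish_cell x 3 (cell_inv s u (Suc j))"
    if x: "scan_inv s u j m s x" for x
  proof (rule terminates_loop_free)
    obtain r' m' where x': "x = (r', m')" by (cases x)
    have regs: "at_cell s u j r'" "m' = m" and best: "y < r' ''best'' \<longleftrightarrow> found s u j s 0 y" for y
      using x unfolding x' scan_inv_def by simp_all
    have "table (m(cell s u j := r' ''best'')) (Suc (cell s u j))"
      by (rule table_update[OF tab u j]) (simp add: best found_all[OF s])
    then show "cell_inv s u (Suc j) (result F finish_cell x)"
      using regs by (simp add: x' finish_cell_def inv_defs cell_Suc)
  qed (simp_all add: finish_cell_def)
  have "terminates F (WhileLess ''s2'' ''s'' relax_time ;; finish_cell) (result F start_cell (r, m))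
      (s * (25 * n + 1) + 1 + 3) (cell_inv s u (Suc j))"
    by (rule terminates_Seq[OF terminates_mono[OF loop order_refl finish]]) simp_all
  then show "terminates F (WhileLess ''s2'' ''s'' relax_time ;; finish_cell) (result F start_cell (r, m))
      (s * (25 * n + 1) + 1 + 3) (cell_inv s u (Suc j))"
    by simp
qed (simp_all add: start_cell_def)

lemma fill_vertex_spec:
  assumes inv: "vertex_inv s u (r, m)" and s: "s < T" and u: "u < n"
  shows "terminates F fill_vertex (r, m) (45 * (n * T * k)) (vertex_inv s (Suc u))"
  unfolding fill_vertex_def
proof (rule terminates_prefix[where a = 1 and b = "k * (40 * (n * T) + 1) + 1 + 1"])
  have "1 \<le> n * T" using n_pos s by simp
  then have "k * (40 * (n * T) + 1) \<le> k * (41 * (n * T))"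
    by (intro mult_left_mono) simp_all
  also have "\<dots> = 41 * (n * T * k)" by (simp only: ac_simps)
  finally show "1 + (k * (40 * (n * T) + 1) + 1 + 1) \<le> 45 * (n * T * k)"
    using mult_le_mono[OF \<open>1 \<le> n * T\<close> k_pos] by linarith
  have start: "cell_inv s u 0 (r(''j'' := 0), m)"
    using inv by (simp add: inv_defs)
  have loop: "terminates F (WhileLess ''j'' ''k'' fill_cell) (r(''j'' := 0), m)
      (k * (40 * (n * T) + 1) + 1) (cell_inv s u k)"
  proof (rule terminates_While[where I = "cell_inv s u", OF start])
    fix j r m
    assume j: "j < k" and inv': "cell_inv s u j (r, m)"
    have "r ''j'' < r ''k''"
      using j inv' by (simp add: inv_defs)
    then show "r ''j'' < r ''k'' \<and>
        terminates F fill_cell (r, m) (40 * (n * T)) (cell_inv s u (Suc j))"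
      using fill_cell_spec[OF inv' s u j] by simp
  qed (simp add: inv_defs)
  have finish: "terminates F (Add ''u'' ''u'' ''one'') x 1 (vertex_inv s (Suc u))"
    if x: "cell_inv s u k x" for x
  proof (rule terminates_loop_free)
    obtain r' m' where "x = (r', m')" by (cases x)
    with x show "vertex_inv s (Suc u) (result F (Add ''u'' ''u'' ''one'') x)"
      by (simp add: inv_defs cell_row_end)
  qed simp_all
  have "terminates F (WhileLess ''j'' ''k'' fill_cell ;; Add ''u'' ''u'' ''one'') (r(''j'' := 0), m)
      (k * (40 * (n * T) + 1) + 1 + 1) (vertex_inv s (Suc u))"
    by (rule terminates_Seq[OF terminates_mono[OF loop order_refl finish]]) simp_all
  then show "terminates F (WhileLess ''j'' ''k'' fill_cell ;; Add ''u'' ''u'' ''one'')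
      (result F (Const ''j'' 0) (r, m))
      (k * (40 * (n * T) + 1) + 1 + 1) (vertex_inv s (Suc u))"
    by simp
qed simp_all

lemma fill_time_spec:
  assumes inv: "time_inv s (r, m)" and s: "s < T"
  shows "terminates F fill_time (r, m) (50 * (n * (n * T * k))) (time_inv (Suc s))"
  unfolding fill_time_def
proof (rule terminates_prefix[where a = 1 and b = "n * (45 * (n * T * k) + 1) + 1 + 2"])
  have 1: "1 \<le> n * T * k" using n_pos s k_pos by simp
  then have "n * (45 * (n * T * k) + 1) \<le> n * (46 * (n * T * k))"
    by (intro mult_left_mono) simp_all
  also have "\<dots> = 46 * (n * (n * T * k))" by (simp only: ac_simps)
  finally show "1 + (n * (45 * (n * T * k) + 1) + 1 + 2) \<le> 50 * (n * (n * T * k))"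
    using mult_le_mono[OF n_pos 1] by linarith
  have start: "vertex_inv s 0 (r(''u'' := 0), m)"
    using inv by (simp add: inv_defs)
  have loop: "terminates F (WhileLess ''u'' ''n'' fill_vertex) (r(''u'' := 0), m)
      (n * (45 * (n * T * k) + 1) + 1) (vertex_inv s n)"
  proof (rule terminates_While[where I = "vertex_inv s", OF start])
    fix u r m
    assume u: "u < n" and inv': "vertex_inv s u (r, m)"
    have "r ''u'' < r ''n''"
      using u inv' by (simp add: inv_defs)
    then show "r ''u'' < r ''n'' \<and>
        terminates F fill_vertex (r, m) (45 * (n * T * k)) (vertex_inv s (Suc u))"
      using fill_vertex_spec[OF inv' s u] by simp
  qed (simp add: inv_defs)
  have finish: "terminates F (Sub ''t'' ''t'' ''one'' ;; Add ''s'' ''s'' ''one'') x 2 (time_inv (Suc s))"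
    if x: "vertex_inv s n x" for x
  proof (rule terminates_loop_free)
    obtain r' m' where "x = (r', m')" by (cases x)
    with x show "time_inv (Suc s) (result F (Sub ''t'' ''t'' ''one'' ;; Add ''s'' ''s'' ''one'') x)"
      by (simp add: inv_defs cell_layer_end)
  qed simp_all
  have "terminates F (WhileLess ''u'' ''n'' fill_vertex ;; Sub ''t'' ''t'' ''one'' ;;
      Add ''s'' ''s'' ''one'') (r(''u'' := 0), m) (n * (45 * (n * T * k) + 1) + 1 + 2) (time_inv (Suc s))"
    by (rule terminates_Seq[OF terminates_mono[OF loop order_refl finish]]) simp_all
  then show "terminates F (WhileLess ''u'' ''n'' fill_vertex ;;
      Sub ''t'' ''t'' ''one'' ;; Add ''s'' ''s'' ''one'') (result F (Const ''u'' 0) (r, m))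
      (n * (45 * (n * T * k) + 1) + 1 + 2) (time_inv (Suc s))"
    by simp
qed simp_all

section \<open>Reading the answer and the total time\<close>

lemma rewind_spec:
  assumes inv: "rewind_inv i (r, m)" and i: "i < n - vs"
  shows "terminates F rewind (r, m) 2 (rewind_inv (Suc i))"
proof (rule terminates_loop_free)
  have "n - i = Suc (n - Suc i)" using i by simp
  then have "cell (T - 1) (n - i) 0 - k = cell (T - 1) (n - Suc i) 0"
    by (metis cell_row_end cell_def diff_add_inverse2 add_0_right)
  with inv show "rewind_inv (Suc i) (result F rewind (r, m))"
    by (simp add: inv_defs rewind_def)
qed (simp_all add: rewind_def)

lemma read_answer_spec:
  assumes inv: "rewind_inv (n - vs) (r, m)"
  shows "fst (result F read_answer (r, m)) ''out'' =
    of_bool (afford 1 vs (k - card {vs, vt}) 0)"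
proof -
  let ?g = "k - card {vs, vt}"
  \<comment> \<open>Rows hold only needs below \<open>k\<close>. At least one endpoint is deducted,
    so for positive \<open>k\<close> the initial need has a column.\<close>
  have g: "?g < k" using k_pos by (simp add: card_insert_if)
  have T: "T - 1 < T" "T - (T - 1) = 1" using T_ge_2 by simp_all
  have "n - (n - vs) = vs" using vs_less by simp
  with inv have regs: "r ''q'' + r ''g'' = cell (T - 1) vs ?g" "r ''zero'' = 0"
    "table m (cell T 0 0)"
    by (simp_all add: inv_defs cell_def)
  \<comment> \<open>A positive entry says that having spent 0 is affordable; layer
    \<open>T - 1\<close> is time 1.\<close>
  have "0 < m (cell (T - 1) vs ?g) \<longleftrightarrow> afford 1 vs ?g 0"
    using regs(3) T vs_less g cell_less_layer[OF T(1) vs_less g] unfolding table_def by metis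
  then show ?thesis
    by (simp add: read_answer_def regs)
qed

lemma orienteering_program_spec:
  "terminates F orienteering_program (input_state n T vs vt k f) (80 * (n * T * k)\<^sup>2)
     (\<lambda>(r, m). r ''out'' = of_bool (afford 1 vs (k - card {vs, vt}) 0))"
proof -
  define A where "A = n * (n * T * k)"
  define x where "x = result F setup_registers (input_state n T vs vt k f)"
  let ?Q = "\<lambda>(r, m). r ''out'' = of_bool (afford 1 vs (k - card {vs, vt}) 0)"
  have start: "time_inv 0 x"
    by (simp add: x_def setup_registers_def input_state_def inv_defs cell_def table_def)
  have fill: "terminates F (WhileLess ''s'' ''T'' fill_time) x (T * (50 * A + 1) + 1) (time_inv T)"
  proof (rule terminates_While[where I = time_inv, OF start])
    fix s r m
    assume s: "s < T" and inv: "time_inv s (r, m)"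
    have "r ''s'' < r ''T''"
      using s inv by (simp add: inv_defs)
    then show "r ''s'' < r ''T'' \<and> terminates F fill_time (r, m) (50 * A) (time_inv (Suc s))"
      using fill_time_spec[OF inv s] by (simp add: A_def)
  qed (simp add: inv_defs)
  have rewind: "terminates F (WhileLess ''vs'' ''n'' rewind) y ((n - vs) * (2 + 1) + 1)
      (rewind_inv (n - vs))" if y: "time_inv T y" for y
  proof (rule terminates_While[where I = rewind_inv])
    obtain r m where "y = (r, m)" by (cases y)
    moreover have "cell T 0 0 = cell (T - 1) n 0"
      using T_ge_2 by (simp add: cell_layer_end)
    ultimately show "rewind_inv 0 y"
      using y by (simp add: inv_defs)
  next
    fix i r m
    assume i: "i < n - vs" and inv: "rewind_inv i (r, m)"
    have "r ''vs'' < r ''n''"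
      using i inv by (simp add: inv_defs)
    then show "r ''vs'' < r ''n'' \<and> terminates F rewind (r, m) 2 (rewind_inv (Suc i))"
      using rewind_spec[OF inv i] by simp
  qed (use vs_less in \<open>simp add: inv_defs\<close>)
  have read: "terminates F read_answer z 4 ?Q" if z: "rewind_inv (n - vs) z" for z
  proof (rule terminates_loop_free)
    obtain r m where "z = (r, m)" by (cases z)
    with z read_answer_spec[of r m] show "?Q (result F read_answer z)"
      by (simp add: split_beta)
  qed (simp_all add: read_answer_def)
  have rewind_read: "terminates F (WhileLess ''vs'' ''n'' rewind ;; read_answer) y
      ((n - vs) * (2 + 1) + 1 + 4) ?Q" if "time_inv T y" for y
    by (rule terminates_Seq[OF terminates_mono[OF rewind[OF that] order_refl read]]) simp_all
  have all: "terminates F (WhileLess ''s'' ''T'' fill_time ;; WhileLess ''vs'' ''n'' rewind ;;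
      read_answer) x (T * (50 * A + 1) + 1 + ((n - vs) * (2 + 1) + 1 + 4)) ?Q"
    by (rule terminates_Seq[OF terminates_mono[OF fill order_refl rewind_read]]) simp_all
  let ?M = "(n * T * k)\<^sup>2"
  have pos: "1 \<le> T" "1 \<le> k" "1 \<le> A"
    using T_ge_2 k_pos n_pos by (simp_all add: A_def)
  \<comment> \<open>The loops are bounded in terms of \<open>T * A\<close>, that is
    \<open>n^2 * T^2 * k\<close>; one more factor \<open>k\<close> completes the square.\<close>
  have "T * A * 1 \<le> T * A * k"
    using k_pos by (intro mult_left_mono) simp_all
  also have "T * A * k = ?M"
    by (simp add: A_def power2_eq_square algebra_simps)
  finally have M: "T * A \<le> ?M" by simp
  have "T * (50 * A + 1) \<le> T * (51 * A)"
    using pos by (intro mult_left_mono) simp_all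
  also have "\<dots> = 51 * (T * A)" by simp
  finally have "T * (50 * A + 1) \<le> 51 * (T * A)" .
  moreover have "n \<le> A"
    using n_pos pos by (simp add: A_def)
  moreover have "A \<le> T * A"
    using pos by simp
  moreover have "7 + (a + 1 + ((n - vs) * (2 + 1) + 1 + 4)) \<le> 80 * ?M"
    if "a \<le> 51 * b" "n \<le> A" "A \<le> b" "b \<le> ?M" for a b
    using that pos by simp
  ultimately have "7 + (T * (50 * A + 1) + 1 + ((n - vs) * (2 + 1) + 1 + 4)) \<le> 80 * ?M"
    using M by blast
  then show ?thesis
    unfolding orienteering_program_def
    by (rule terminates_prefix[OF _ _ all[unfolded x_def], of 7, rotated 2])
      (simp_all add: setup_registers_def)
qed

lemma orienteering_program_decides:
  "decides_within F orienteering_program (input_state n T vs vt k f)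
     (orienteering {0..<n} T F vs vt k f) (80 * (n * T * k)\<^sup>2)"
  using orienteering_program_spec
  unfolding terminates_def decides_within_def orienteering_iff_afford by auto

end

theorem theorem3:
  "\<exists>(P :: com) (c :: nat).
     \<forall>(n :: nat) (E :: (nat \<times> nat) set) (T :: nat) (F :: nat cost_fun)
      (vs :: nat) (vt :: nat) (k :: nat) (f :: nat).
       temporal_cost_graph {0..<n} E T F \<longrightarrow>
       has_lifetime {0..<n} T F \<longrightarrow>
       (\<forall>v\<in>{0..<n}. card (incident_triples {0..<n} T F v) \<le> 3) \<longrightarrow>
       vs \<in> {0..<n} \<longrightarrow> vt \<in> {0..<n} \<longrightarrow> 1 \<le> k \<longrightarrow>
       decides_within F P (input_state n T vs vt k f)
         (orienteering {0..<n} T F vs vt k f) (c * (n * T * k)\<^sup>2)"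
proof (intro exI allI impI)
  fix n T vs vt k f :: nat and E :: "(nat \<times> nat) set" and F :: "nat cost_fun"
  assume "temporal_cost_graph {0..<n} E T F" "has_lifetime {0..<n} T F"
    "\<forall>v\<in>{0..<n}. card (incident_triples {0..<n} T F v) \<le> 3"
    "vs \<in> {0..<n}" "vt \<in> {0..<n}" "1 \<le> k"
  then interpret numbered_instance n E T F vs vt k f
    by unfold_locales auto
  show "decides_within F orienteering_program (input_state n T vs vt k f)
      (orienteering {0..<n} T F vs vt k f) (80 * (n * T * k)\<^sup>2)"
    by (rule orienteering_program_decides)
qed

end
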